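(* For any dimension $n\geq 1$ the Lorenz-96 model is $\Gamma_n$-equivariant, i.e. $f_n(\gamma x,F)=\gamma f_n(x,F)$ for all $\gamma\in\Gamma_n$, $x\in\mathbb{R}^n$ and $F\in\mathbb{R}$.
   Context: The $n$-dimensional Lorenz-96 model with parameter $F\in\mathbb{R}$ is the system of ordinary differential equations $\dot x=f_n(x,F)$ on $\mathbb{R}^n$, where $f_n:\mathbb{R}^n\times\mathbb{R}\to\mathbb{R}^n$ has $j$-th component $x_{j-1}(x_{j+1}-x_{j-2}) - x_j + F$, $j=1,\ldots,n$, with all indices taken modulo $n$ (i.e. $x_{j-n}=x_{j+n}=x_j$). Let $\gamma_n:\mathbb{R}^n\to\mathbb{R}^n$ be the cyclic left shift $\gamma_n(x_1,x_2,\ldots,x_n)=(x_2,\ldots,x_n,x_1)$ (a permutation matrix), and let $\Gamma_n=\langle\gamma_n\rangle$ be the cyclic group it generates, which is isomorphic to $\mathbb{Z}/n\mathbb{Z}$. *)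

theory Defs
  imports "HOL-Algebra.Bij" "HOL-Algebra.Generated_Groups" "Jordan_Normal_Form.Matrix"
begin

text \<open>
  \<open>\<real>\<^sup>n\<close> is \<open>carrier_vec n :: real vec set\<close>. Its entries are numbered \<open>0, \<dots>, n - 1\<close>
  instead of \<open>1, \<dots>, n\<close>; the right-hand side of the model only involves index differences,
  so its formula is unaffected by this renumbering.
\<close>

definition cyc_index :: "'a vec \<Rightarrow> int \<Rightarrow> 'a" where
  "cyc_index x k = x $ nat (k mod int (dim_vec x))"

definition lorenz96 :: "nat \<Rightarrow> real vec \<Rightarrow> real \<Rightarrow> real vec" where
  "lorenz96 n x F = vec n (\<lambda>i. let j = int i in
     cyc_index x (j - 1) * (cyc_index x (j + 1) - cyc_index x (j - 2)) - cyc_index x j + F)"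

text \<open>
  The restriction to \<open>carrier_vec n\<close> is needed for the map to be an element of
  \<open>BijGroup (carrier_vec n)\<close>, whose carrier consists of extensional functions.
\<close>

definition cyc_shift :: "nat \<Rightarrow> real vec \<Rightarrow> real vec" where
  "cyc_shift n = (\<lambda>x\<in>carrier_vec n. vec n (\<lambda>i. if i + 1 < n then x $ (i + 1) else x $ 0))"

definition cyc_group :: "nat \<Rightarrow> (real vec \<Rightarrow> real vec) set" where
  "cyc_group n = generate (BijGroup (carrier_vec n)) {cyc_shift n}"

lemma cyc_shift_in_BijGroup: "cyc_shift n \<in> carrier (BijGroup (carrier_vec n))"
proof -
  have "bij_betw (cyc_shift n) (carrier_vec n) (carrier_vec n)"
  proof (rule bij_betw_byWitness[where f' = "\<lambda>x. vec n (\<lambda>i. if i = 0 then x $ (n - 1) else x $ (i - 1))"])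
    show "\<forall>x\<in>carrier_vec n. vec n (\<lambda>i. if i = 0 then cyc_shift n x $ (n - 1) else cyc_shift n x $ (i - 1)) = x"
      by (auto simp: cyc_shift_def intro!: eq_vecI)
    show "\<forall>x\<in>carrier_vec n. cyc_shift n (vec n (\<lambda>i. if i = 0 then x $ (n - 1) else x $ (i - 1))) = x"
    proof (intro ballI eq_vecI)
      fix x :: "real vec" and i assume x: "x \<in> carrier_vec n" and i: "i < dim_vec x"
      show "cyc_shift n (vec n (\<lambda>i. if i = 0 then x $ (n - 1) else x $ (i - 1))) $ i = x $ i"
      proof (cases "i + 1 < n")
        case False
        then have "i = n - 1" using i x by auto
        then show ?thesis using i x by (auto simp: cyc_shift_def)
      qed (use i x in \<open>auto simp: cyc_shift_def\<close>)
    qed (auto simp: cyc_shift_def)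
  qed (auto simp: cyc_shift_def)
  then show ?thesis
    by (simp add: BijGroup_def Bij_def) (simp add: cyc_shift_def)
qed

lemma cyc_group_subgroup: "subgroup (cyc_group n) (BijGroup (carrier_vec n))"
  unfolding cyc_group_def
  by (rule group.generate_is_subgroup[OF group_BijGroup]) (simp add: cyc_shift_in_BijGroup)

lemma cyc_shift_permutation_matrix:
  assumes "x \<in> carrier_vec n"
  shows "cyc_shift n x = mat n n (\<lambda>(i, j). if j = (i + 1) mod n then 1 else 0) *\<^sub>v x"
proof (rule eq_vecI)
  fix i assume "i < dim_vec (mat n n (\<lambda>(i, j). if j = (i + 1) mod n then 1 else 0) *\<^sub>v x)"
  then have i: "i < n" by simp
  then have "(mat n n (\<lambda>(i, j). if j = (i + 1) mod n then 1 else 0) *\<^sub>v x) $ i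
      = (\<Sum>j = 0..<n. if j = (i + 1) mod n then x $ j else 0)"
    using assms by (auto simp: scalar_prod_def if_distrib[of "\<lambda>c. c * _"] simp del: sum.delta intro!: sum.cong)
  also have "\<dots> = x $ ((i + 1) mod n)" using i by simp
  also have "\<dots> = cyc_shift n x $ i"
  proof (cases "i + 1 < n")
    case False
    then have "i + 1 = n" using i by simp
    then show ?thesis using i assms by (simp add: cyc_shift_def)
  qed (use i assms in \<open>simp add: cyc_shift_def\<close>)
  finally show "cyc_shift n x $ i
      = (mat n n (\<lambda>(i, j). if j = (i + 1) mod n then 1 else 0) *\<^sub>v x) $ i" by simp
qed (use assms in \<open>simp add: cyc_shift_def\<close>)

end

theory Submission
  imports Defs
begin

text \<open>The bijections of a set that commute with a fixed self-map form a subgroup of its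
  symmetric group, so equivariance under \<open>cyc_group n\<close> reduces to the single generator
  \<open>cyc_shift n\<close> (\<open>lorenz96_cyc_shift\<close>). For the generator, view a vector
  as an n-periodic function on the integers via \<open>cyc_index\<close>: the shift becomes
  translation by 1, and the Lorenz-96 formula, which involves only relative indices, is translation
  invariant.\<close>

lemma subgroup_commuting_Bij:
  assumes f: "f \<in> S \<rightarrow> S"
  shows "subgroup {g \<in> Bij S. \<forall>x\<in>S. f (g x) = g (f x)} (BijGroup S)"
proof (rule group.subgroupI[OF group_BijGroup])
  have "(\<lambda>x\<in>S. x) \<in> {g \<in> Bij S. \<forall>x\<in>S. f (g x) = g (f x)}"
    using f by (auto simp: id_Bij)
  then show "{g \<in> Bij S. \<forall>x\<in>S. f (g x) = g (f x)} \<noteq> {}"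
    by blast
next
  fix g assume g: "g \<in> {g \<in> Bij S. \<forall>x\<in>S. f (g x) = g (f x)}"
  then have bij: "bij_betw g S S"
    by (simp add: Bij_def)
  \<comment> \<open>Apply commutation at the preimage of \<open>x\<close> under \<open>g\<close>,
    then cancel \<open>g\<close>; the cancellation requires \<open>f\<close> to keep that preimage
    in \<open>S\<close>.\<close>
  have "f (inv_into S g x) = inv_into S g (f x)" if x: "x \<in> S" for x
  proof -
    have y: "inv_into S g x \<in> S" and gy: "g (inv_into S g x) = x"
      using bij x by (auto simp: bij_betw_def inv_into_into f_inv_into_f)
    have "g (f (inv_into S g x)) = f x"
      using g y gy by force
    moreover have "f (inv_into S g x) \<in> S"
      using f y by blast
    ultimately show ?thesis
      using bij by (metis bij_betw_inv_into_left)
  qed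
  then show "inv\<^bsub>BijGroup S\<^esub> g \<in> {g \<in> Bij S. \<forall>x\<in>S. f (g x) = g (f x)}"
    using f g by (auto simp: inv_BijGroup restrict_inv_into_Bij)
next
  fix g h
  assume g: "g \<in> {g \<in> Bij S. \<forall>x\<in>S. f (g x) = g (f x)}"
    and h: "h \<in> {g \<in> Bij S. \<forall>x\<in>S. f (g x) = g (f x)}"
  have "h x \<in> S" if "x \<in> S" for x
    using h Bij_imp_funcset that by fastforce
  then show "g \<otimes>\<^bsub>BijGroup S\<^esub> h \<in> {g \<in> Bij S. \<forall>x\<in>S. f (g x) = g (f x)}"
    using f g h by (auto simp: BijGroup_def compose_Bij compose_eq Pi_iff)
qed (auto simp: BijGroup_def)

lemma lorenz96_carrier: "lorenz96 n x F \<in> carrier_vec n"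
  by (simp add: lorenz96_def)

lemma cyc_shift_nth:
  assumes "x \<in> carrier_vec n" "i < n"
  shows "cyc_shift n x $ i = cyc_index x (int i + 1)"
proof (cases "i + 1 < n")
  case True
  then have "nat ((int i + 1) mod int n) = i + 1"
    by (simp add: nat_add_distrib)
  with True assms show ?thesis
    by (simp add: cyc_shift_def cyc_index_def)
next
  case False
  \<comment> \<open>The wrap-around: \<open>i\<close> is the last position, and \<open>n\<close> has
    residue 0, so both sides read \<open>x $ 0\<close>.\<close>
  then have "int i + 1 = int n"
    using assms by simp
  with False assms show ?thesis
    by (simp add: cyc_shift_def cyc_index_def)
qed

text \<open>Extends \<open>cyc_shift_nth\<close> from positions below \<open>n\<close> to all
  integers, since reducing \<open>k\<close> modulo \<open>n\<close> before adding 1 does not change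
  the residue.\<close>

lemma cyc_index_cyc_shift:
  assumes "x \<in> carrier_vec n" "n \<ge> 1"
  shows "cyc_index (cyc_shift n x) k = cyc_index x (k + 1)"
proof -
  have "nat (k mod int n) < n"
    using assms by (simp add: nat_less_iff)
  then show ?thesis
    using assms cyc_shift_nth[of x n "nat (k mod int n)"]
    by (simp add: cyc_index_def cyc_shift_def mod_simps)
qed

text \<open>Both sides are n-periodic in \<open>k\<close>, so the defining formula persists beyond
  the range of positions. This matters at \<open>k = n\<close>, which the shift reaches from the
  last entry.\<close>

lemma cyc_index_lorenz96:
  assumes "x \<in> carrier_vec n" "n \<ge> 1"
  shows "cyc_index (lorenz96 n x F) k =
    cyc_index x (k - 1) * (cyc_index x (k + 1) - cyc_index x (k - 2)) - cyc_index x k + F"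
proof -
  have "nat (k mod int n) < n"
    using assms by (simp add: nat_less_iff)
  then show ?thesis
    using assms by (simp add: cyc_index_def lorenz96_def Let_def mod_simps)
qed

lemma lorenz96_cyc_shift:
  assumes "x \<in> carrier_vec n" "n \<ge> 1"
  shows "lorenz96 n (cyc_shift n x) F = cyc_shift n (lorenz96 n x F)"
proof (rule eq_vecI)
  show "dim_vec (lorenz96 n (cyc_shift n x) F) = dim_vec (cyc_shift n (lorenz96 n x F))"
    using lorenz96_carrier[of n x F] by (simp add: lorenz96_def cyc_shift_def)
  fix i assume "i < dim_vec (cyc_shift n (lorenz96 n x F))"
  then have "i < n"
    by (simp add: cyc_shift_def lorenz96_carrier)
  \<comment> \<open>Translation invariance: on the left the offset is taken before the shift, on the
    right after it.\<close>
  moreover have "int i - 1 + 1 = int i + 1 - 1" "int i - 2 + 1 = int i + 1 - 2"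
    by simp_all
  ultimately show "lorenz96 n (cyc_shift n x) F $ i = cyc_shift n (lorenz96 n x F) $ i"
    using assms
    by (simp only: cyc_shift_nth lorenz96_carrier cyc_index_lorenz96)
      (simp add: lorenz96_def Let_def cyc_index_cyc_shift)
qed

theorem proposition1:
  fixes n :: nat
  assumes "n \<ge> 1"
  shows "\<forall>g\<in>cyc_group n. \<forall>x\<in>carrier_vec n. \<forall>F::real.
           lorenz96 n (g x) F = g (lorenz96 n x F)"
proof (intro ballI allI)
  fix g and x :: "real vec" and F :: real
  assume g: "g \<in> cyc_group n" and x: "x \<in> carrier_vec n"
  \<comment> \<open>With \<open>F\<close> fixed, this is the subgroup of bijections commuting with
    one self-map of \<open>carrier_vec n\<close>.\<close>
  let ?C = "{g \<in> Bij (carrier_vec n). \<forall>x\<in>carrier_vec n. lorenz96 n (g x) F = g (lorenz96 n x F)}"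
  have "subgroup ?C (BijGroup (carrier_vec n))"
    by (rule subgroup_commuting_Bij) (simp add: lorenz96_carrier)
  moreover have "cyc_shift n \<in> ?C"
    using cyc_shift_in_BijGroup[of n] assms by (simp add: BijGroup_def lorenz96_cyc_shift)
  ultimately have "cyc_group n \<subseteq> ?C"
    unfolding cyc_group_def
    by (intro group.generate_subgroup_incl[OF group_BijGroup]) simp_all
  with g x show "lorenz96 n (g x) F = g (lorenz96 n x F)"
    by blast
qed

end
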